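(* Let $\phi:\mathbb R\to[0,+\infty]$ be an Orlicz function with $ces_\phi\neq\{0\}$. If $x\in l^0$, $\{x_n\}\subset ces_\phi$, $\sup_n\|x_n\|_\phi<\infty$ and $0\le x_n\uparrow x$ coordinatewise (i.e. for every $i\in\mathbb N$ the sequence $(x_n(i))_n$ is nonnegative, nondecreasing and converges to $x(i)$), then $x\in ces_\phi$ and $\|x_n\|_\phi\to\|x\|_\phi$.
   Context: A map $\phi:\mathbb R\to[0,+\infty]$ is an Orlicz function if it is even, convex, left continuous on $\mathbb R_+=[0,\infty)$, continuous at zero, $\phi(0)=0$ and $\phi(u)\to\infty$ as $u\to\infty$ (the value $+\infty$ is allowed). Let $l^0$ be the space of all real sequences $x=(x(i))_{i=1}^\infty$. For $x\in l^0$ put $\sigma x(i)=\frac1i\sum_{j=1}^i|x(j)|$ and $\rho_\phi(x)=\sum_{i=1}^\infty\phi(\sigma x(i))$. The Cesàro–Orlicz sequence space is $ces_\phi=\{x\in l^0:\ \rho_\phi(\lambda x)<\infty\text{ for some }\lambda>0\}$, equipped with the Luxemburg norm $\|x\|_\phi=\inf\{\lambda>0:\rho_\phi(x/\lambda)\le1\}$. *)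

theory Defs
  imports "HOL-Analysis.Analysis"
begin

text \<open>
  The library's \<open>convex_on\<close> is for real-valued functions, so convexity of a
  \<open>[0, \<infinity>]\<close>-valued function is spelled out. In \<^typ>\<open>ennreal\<close> one has
  \<open>0 * \<infinity> = 0\<close>, so the inequality is harmless for \<open>t = 0\<close> and \<open>t = 1\<close>.
\<close>

definition convex_ennreal :: "(real \<Rightarrow> ennreal) \<Rightarrow> bool" where
  "convex_ennreal \<phi> \<longleftrightarrow>
     (\<forall>u v t. 0 \<le> t \<and> t \<le> 1 \<longrightarrow>
        \<phi> ((1 - t) * u + t * v) \<le> ennreal (1 - t) * \<phi> u + ennreal t * \<phi> v)"

definition orlicz_function :: "(real \<Rightarrow> ennreal) \<Rightarrow> bool" where
  "orlicz_function \<phi> \<longleftrightarrow>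
     (\<forall>u. \<phi> (- u) = \<phi> u) \<and>
     convex_ennreal \<phi> \<and>
     (\<forall>u\<ge>0. continuous (at_left u) \<phi>) \<and>
     isCont \<phi> 0 \<and>
     \<phi> 0 = 0 \<and>
     (\<phi> \<longlongrightarrow> \<infinity>) at_top"

text \<open>
  A real sequence \<open>(x(1), x(2), \<dots>)\<close> is a function \<^typ>\<open>nat \<Rightarrow> real\<close> whose value
  at \<open>i\<close> is the entry \<open>x(i + 1)\<close>; hence the divisor \<^term>\<open>Suc i\<close> in the mean below.
\<close>

definition cesaro_mean :: "(nat \<Rightarrow> real) \<Rightarrow> nat \<Rightarrow> real" where
  "cesaro_mean x i = (1 / real (Suc i)) * (\<Sum>j\<le>i. \<bar>x j\<bar>)"

definition ces_modular :: "(real \<Rightarrow> ennreal) \<Rightarrow> (nat \<Rightarrow> real) \<Rightarrow> ennreal" where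
  "ces_modular \<phi> x = (\<Sum>i. \<phi> (cesaro_mean x i))"

definition ces_space :: "(real \<Rightarrow> ennreal) \<Rightarrow> (nat \<Rightarrow> real) set" where
  "ces_space \<phi> = {x. \<exists>c>0. ces_modular \<phi> (\<lambda>i. c * x i) < \<infinity>}"

text \<open>
  A real infimum, meaningful only for \<open>x\<close> in \<open>ces_space \<phi>\<close>, where for an Orlicz
  function \<open>\<phi>\<close> the set is nonempty; outside the space the set is empty and the
  value is unspecified.
\<close>

definition luxemburg_norm :: "(real \<Rightarrow> ennreal) \<Rightarrow> (nat \<Rightarrow> real) \<Rightarrow> real" where
  "luxemburg_norm \<phi> x = Inf {c. c > 0 \<and> ces_modular \<phi> (\<lambda>i. x i / c) \<le> 1}"

end

theory Submission
  imports Defs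
begin

text \<open>
  The norm is monotone on nonnegative sequences, so the norms increase to some \<open>M\<close> bounded by
  the norm of \<open>x\<close>. Conversely, for \<open>c > M\<close> all \<open>X n / c\<close> have modular at most one; left
  continuity of \<open>\<phi>\<close> carries the bound over to each partial sum of the modular of \<open>x / c\<close>
  (Fatou property). Hence \<open>x\<close> lies in the space and has norm at most \<open>c\<close>.
\<close>

text \<open>Convexity on the segment from the origin to \<open>v\<close>, where the endpoint value
  \<open>\<phi> 0 = 0\<close> drops out.\<close>

lemma orlicz_scale_le:
  assumes "orlicz_function \<phi>" "0 \<le> t" "t \<le> 1"
  shows "\<phi> (t * v) \<le> ennreal t * \<phi> v"
proof -
  have "\<phi> ((1 - t) * 0 + t * v) \<le> ennreal (1 - t) * \<phi> 0 + ennreal t * \<phi> v"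
    using assms unfolding orlicz_function_def convex_ennreal_def by blast
  then show ?thesis using assms by (simp add: orlicz_function_def)
qed

lemma orlicz_mono:
  assumes "orlicz_function \<phi>" "0 \<le> u" "u \<le> v"
  shows "\<phi> u \<le> \<phi> v"
proof (cases "v = 0")
  case False
  with assms have v: "v > 0" by simp
  \<comment> \<open>Here \<open>u\<close> is written as a contraction of \<open>v\<close> towards
    the origin, with ratio \<open>u / v\<close> at most 1.\<close>
  have "\<phi> (u / v * v) \<le> ennreal (u / v) * \<phi> v"
    using assms v by (intro orlicz_scale_le) auto
  also have "\<dots> \<le> 1 * \<phi> v"
    using assms v by (intro mult_right_mono) (auto simp: ennreal_le_1)
  finally show ?thesis using v by simp
qed (use assms in auto)

lemma orlicz_tendsto_from_below:
  assumes "orlicz_function \<phi>" "0 \<le> a" "\<And>n. f n \<le> a" "f \<longlonglongrightarrow> a"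
  shows "(\<lambda>n. \<phi> (f n)) \<longlonglongrightarrow> \<phi> a"
proof -
  have "(\<phi> \<longlongrightarrow> \<phi> a) (at a within {..<a})"
    using assms unfolding orlicz_function_def continuous_within by blast
  \<comment> \<open>The sequence \<open>f\<close> may attain \<open>a\<close>, so the left
    neighbourhoods must contain \<open>a\<close> itself; adding that point is harmless because the
    limit is the value there.\<close>
  then have "(\<phi> \<longlongrightarrow> \<phi> a) (inf (nhds a) (principal {..a}))"
    unfolding tendsto_def eventually_at_filter eventually_inf_principal
    by (fastforce elim!: eventually_mono)
  moreover have "filterlim f (inf (nhds a) (principal {..a})) sequentially"
    using assms by (auto simp: filterlim_inf filterlim_principal)
  ultimately show ?thesis by (rule filterlim_compose)
qed

lemma cesaro_mean_scale: "cesaro_mean (\<lambda>i. c * y i) i = \<bar>c\<bar> * cesaro_mean y i"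
  by (simp add: cesaro_mean_def abs_mult sum_distrib_left)

lemma cesaro_mean_nonneg: "0 \<le> cesaro_mean y i"
  by (simp add: cesaro_mean_def sum_nonneg)

lemma cesaro_mean_mono:
  assumes "\<And>i. \<bar>y i\<bar> \<le> \<bar>z i\<bar>"
  shows "cesaro_mean y i \<le> cesaro_mean z i"
  unfolding cesaro_mean_def by (intro mult_left_mono sum_mono assms) auto

lemma ces_modular_mono:
  assumes "orlicz_function \<phi>" "\<And>i. \<bar>y i\<bar> \<le> \<bar>z i\<bar>"
  shows "ces_modular \<phi> y \<le> ces_modular \<phi> z"
  unfolding ces_modular_def
  by (intro suminf_le orlicz_mono[OF assms(1)] cesaro_mean_nonneg cesaro_mean_mono assms(2)) auto

lemma ces_modular_scale_le:
  assumes "orlicz_function \<phi>" "0 \<le> t" "t \<le> 1"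
  shows "ces_modular \<phi> (\<lambda>i. t * y i) \<le> ennreal t * ces_modular \<phi> y"
proof -
  have "ces_modular \<phi> (\<lambda>i. t * y i) \<le> (\<Sum>i. ennreal t * \<phi> (cesaro_mean y i))"
    unfolding ces_modular_def cesaro_mean_scale
    using assms orlicz_scale_le[OF assms] by (intro suminf_le) auto
  then show ?thesis by (simp add: ces_modular_def)
qed

text \<open>Convexity shrinks a finite modular below 1 by scaling. This makes the real infimum in
  the norm meaningful on the space.\<close>

lemma luxemburg_set_nonempty:
  assumes "orlicz_function \<phi>" "y \<in> ces_space \<phi>"
  shows "{c. c > 0 \<and> ces_modular \<phi> (\<lambda>i. y i / c) \<le> 1} \<noteq> {}"
proof -
  obtain c where c: "c > 0" "ces_modular \<phi> (\<lambda>i. c * y i) < \<infinity>"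
    using assms by (auto simp: ces_space_def)
  then obtain r where r: "r \<ge> 0" "ces_modular \<phi> (\<lambda>i. c * y i) = ennreal r"
    by (cases "ces_modular \<phi> (\<lambda>i. c * y i)") auto
  \<comment> \<open>This choice keeps both \<open>t\<close> and \<open>t * r\<close> at most 1, also
    when \<open>r = 0\<close>.\<close>
  define t where "t = 1 / (1 + r)"
  have t: "t > 0" "t \<le> 1" "t * r \<le> 1" using r by (auto simp: t_def)
  have "ces_modular \<phi> (\<lambda>i. t * (c * y i)) \<le> ennreal t * ennreal r"
    using ces_modular_scale_le[OF assms(1), of t "\<lambda>i. c * y i"] t r by simp
  also have "\<dots> \<le> 1" using t r by (simp add: ennreal_mult[symmetric] ennreal_le_1)
  finally have "ces_modular \<phi> (\<lambda>i. y i / (1 / (t * c))) \<le> 1" by (simp add: mult_ac)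
  then show ?thesis using t c by (auto intro!: exI[of _ "1 / (t * c)"])
qed

lemma luxemburg_norm_le:
  assumes "c > 0" "ces_modular \<phi> (\<lambda>i. y i / c) \<le> 1"
  shows "luxemburg_norm \<phi> y \<le> c"
  unfolding luxemburg_norm_def using assms
  by (intro cInf_lower) (auto intro: bdd_belowI[of _ 0])

text \<open>The strict inequality avoids asking whether the infimum is attained: some admissible
  \<open>d\<close> lies below \<open>c\<close>, and the modular decreases as the divisor
  grows.\<close>

lemma ces_modular_le_1:
  assumes "orlicz_function \<phi>" "y \<in> ces_space \<phi>" "luxemburg_norm \<phi> y < c"
  shows "ces_modular \<phi> (\<lambda>i. y i / c) \<le> 1"
proof -
  obtain d where d: "d > 0" "d < c" "ces_modular \<phi> (\<lambda>i. y i / d) \<le> 1"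
    using cInf_lessD[OF luxemburg_set_nonempty[OF assms(1,2)]] assms(3)
    unfolding luxemburg_norm_def by blast
  have "ces_modular \<phi> (\<lambda>i. y i / c) \<le> ces_modular \<phi> (\<lambda>i. y i / d)"
    using d by (intro ces_modular_mono[OF assms(1)]) (auto simp: abs_divide intro!: divide_left_mono)
  with d show ?thesis by simp
qed

lemma luxemburg_norm_nonneg:
  assumes "orlicz_function \<phi>" "y \<in> ces_space \<phi>"
  shows "0 \<le> luxemburg_norm \<phi> y"
  unfolding luxemburg_norm_def using luxemburg_set_nonempty[OF assms] by (intro cInf_greatest) auto

text \<open>Every \<open>c\<close> above the norm of \<open>z\<close> is admissible for
  \<open>y\<close> as well; letting \<open>c\<close> decrease to that norm gives the bound.\<close>

lemma luxemburg_norm_mono: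
  assumes "orlicz_function \<phi>" "z \<in> ces_space \<phi>" "\<And>i. \<bar>y i\<bar> \<le> \<bar>z i\<bar>"
  shows "luxemburg_norm \<phi> y \<le> luxemburg_norm \<phi> z"
proof (rule dense_ge)
  fix c assume c: "luxemburg_norm \<phi> z < c"
  then have "c > 0" using luxemburg_norm_nonneg[OF assms(1,2)] by simp
  moreover have "ces_modular \<phi> (\<lambda>i. y i / c) \<le> ces_modular \<phi> (\<lambda>i. z i / c)"
    using \<open>c > 0\<close> assms by (intro ces_modular_mono) (auto simp: abs_divide divide_right_mono)
  ultimately show "luxemburg_norm \<phi> y \<le> c"
    using ces_modular_le_1[OF assms(1,2) c] by (intro luxemburg_norm_le) auto
qed

text \<open>The domination \<open>le\<close> keeps the means of \<open>Y n\<close> below those of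
  \<open>y\<close>, so left continuity suffices even where \<open>\<phi>\<close> jumps to infinity.
  Only finite sums are passed to the limit in \<open>n\<close>; the bound on them is uniform in
  \<open>N\<close>.\<close>

lemma ces_modular_fatou:
  assumes "orlicz_function \<phi>"
    and le: "\<And>n i. \<bar>Y n i\<bar> \<le> \<bar>y i\<bar>"
    and lim: "\<And>i. (\<lambda>n. Y n i) \<longlonglongrightarrow> y i"
    and bound: "\<And>n. ces_modular \<phi> (Y n) \<le> B"
  shows "ces_modular \<phi> y \<le> B"
proof -
  have "(\<Sum>i<N. \<phi> (cesaro_mean y i)) \<le> B" for N
  proof (rule LIMSEQ_le_const2)
    have "(\<lambda>n. cesaro_mean (Y n) i) \<longlonglongrightarrow> cesaro_mean y i" for i
      unfolding cesaro_mean_def by (intro tendsto_intros lim)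
    then show "(\<lambda>n. \<Sum>i<N. \<phi> (cesaro_mean (Y n) i)) \<longlonglongrightarrow> (\<Sum>i<N. \<phi> (cesaro_mean y i))"
      by (intro tendsto_sum orlicz_tendsto_from_below assms(1) cesaro_mean_nonneg
          cesaro_mean_mono le)
    have "(\<Sum>i<N. \<phi> (cesaro_mean (Y n) i)) \<le> B" for n
      using sum_le_suminf[of "\<lambda>i. \<phi> (cesaro_mean (Y n) i)" "{..<N}"] bound[of n]
      by (auto simp: ces_modular_def intro: order_trans)
    then show "\<exists>M. \<forall>n\<ge>M. (\<Sum>i<N. \<phi> (cesaro_mean (Y n) i)) \<le> B" by blast
  qed
  then show ?thesis unfolding ces_modular_def by (intro suminf_le_const) auto
qed

theorem mainTheorem2:
  fixes \<phi> :: "real \<Rightarrow> ennreal"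
    and x :: "nat \<Rightarrow> real"
    and X :: "nat \<Rightarrow> nat \<Rightarrow> real"
  assumes "orlicz_function \<phi>"
    and "ces_space \<phi> \<noteq> {\<lambda>i. 0}"
    and "\<And>n. X n \<in> ces_space \<phi>"
    and "bdd_above (range (\<lambda>n. luxemburg_norm \<phi> (X n)))"
    and "\<And>n i. 0 \<le> X n i"
    and "\<And>i. incseq (\<lambda>n. X n i)"
    and "\<And>i. (\<lambda>n. X n i) \<longlonglongrightarrow> x i"
  shows "x \<in> ces_space \<phi> \<and>
    (\<lambda>n. luxemburg_norm \<phi> (X n)) \<longlonglongrightarrow> luxemburg_norm \<phi> x"
proof -
  define M where "M = (SUP n. luxemburg_norm \<phi> (X n))"
  have M: "luxemburg_norm \<phi> (X n) \<le> M" for n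
    unfolding M_def by (rule cSUP_upper[OF UNIV_I assms(4)])
  have M0: "0 \<le> M" using luxemburg_norm_nonneg[OF assms(1) assms(3)] M order_trans by blast
  have "X n i \<le> x i" for n i using incseq_le[OF assms(6,7)] .
  then have le: "\<bar>X n i\<bar> \<le> \<bar>x i\<bar>" for n i using assms(5)[of n i] by (smt (verit))
  have mod: "ces_modular \<phi> (\<lambda>i. x i / c) \<le> 1" if "c > M" for c
  proof (rule ces_modular_fatou[OF assms(1), of "\<lambda>n i. X n i / c"])
    have c: "c > 0" using that M0 by simp
    show "\<bar>X n i / c\<bar> \<le> \<bar>x i / c\<bar>" for n i
      using le[of n i] c by (simp add: abs_divide divide_right_mono)
    show "(\<lambda>n. X n i / c) \<longlonglongrightarrow> x i / c" for i
      using c by (intro tendsto_intros assms(7)) auto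
    show "ces_modular \<phi> (\<lambda>i. X n i / c) \<le> 1" for n
      using that M[of n] by (intro ces_modular_le_1 assms(1,3)) simp
  qed
  \<comment> \<open>The divisor must be positive and exceed \<open>M\<close> strictly, and
    \<open>M\<close> may be 0; hence \<open>M + 1\<close>.\<close>
  have "ces_modular \<phi> (\<lambda>i. 1 / (M + 1) * x i) < \<infinity>"
    using mod[of "M + 1"] by (simp add: le_less_trans)
  then have x: "x \<in> ces_space \<phi>"
    using M0 unfolding ces_space_def by (auto intro!: exI[of _ "1 / (M + 1)"])
  have "luxemburg_norm \<phi> x \<le> M"
    by (rule dense_ge) (use mod M0 in \<open>auto intro!: luxemburg_norm_le\<close>)
  \<comment> \<open>Monotonicity of the norm needs the dominating sequence in the space, so this
    bound has to come after \<open>x\<close>.\<close>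
  moreover have "M \<le> luxemburg_norm \<phi> x"
    unfolding M_def by (intro cSUP_least luxemburg_norm_mono assms(1) x le) auto
  moreover have "incseq (\<lambda>n. luxemburg_norm \<phi> (X n))"
    using assms(5,6) by (intro incseq_SucI luxemburg_norm_mono assms(1,3)) (simp add: incseq_SucD[of "\<lambda>n. X n _"])
  then have "(\<lambda>n. luxemburg_norm \<phi> (X n)) \<longlonglongrightarrow> M"
    unfolding M_def by (rule LIMSEQ_incseq_SUP[OF assms(4)])
  ultimately show ?thesis using x by simp
qed

end
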